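(* Let $g:\mathbb{R}_+\to\mathbb{R}$, and let $x^*,\epsilon,\beta,x_0$ be real numbers such that $x^*>\epsilon>0$, $\beta\in(0,1)$, $x_0>x^*$, and, for all $x\in\mathbb{R}_+$, $g(x)>0$ if and only if $x>x^*$. Then the backtracking algorithm started with $x_0$ and $\beta$ finds a solution $\hat{x}$ such that $g(\hat{x})\le 0$ in at most $\lceil \log_\beta(\epsilon/x_0)\rceil$ iterations, and the solution $\hat{x}$ satisfies $\beta x^*<\hat{x}\le x^*$.
   Context: The backtracking algorithm with input $g$, $x_0$, $\beta$ is: set $\tilde{x}\leftarrow x_0$; while $g(\tilde{x})>0$, set $\tilde{x}\leftarrow \beta\tilde{x}$. Its output $\hat{x}$ is the value of $\tilde{x}$ when the loop ends, i.e. the first element of the sequence $x_0, x_0\beta, x_0\beta^2,\dots$ at which $g\le 0$. An iteration is one execution of the loop body $\tilde{x}\leftarrow\beta\tilde{x}$. Here $\log_\beta$ is the logarithm to base $\beta$: $\log_\beta y=\ln y/\ln\beta$. *)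

theory Defs
  imports Complex_Main "HOL-Library.While_Combinator"
begin

text \<open>
  The state of the loop is the pair of the current point and the number of executions of the loop
  body so far; the counter does not influence the run. The result is \<open>None\<close> iff the loop does not
  terminate, and otherwise \<open>Some\<close> of the output and the number of iterations.
\<close>

definition backtracking :: "(real \<Rightarrow> real) \<Rightarrow> real \<Rightarrow> real \<Rightarrow> (real \<times> nat) option" where
  "backtracking g x0 \<beta> =
     while_option (\<lambda>(x, k). g x > 0) (\<lambda>(x, k). (\<beta> * x, Suc k)) (x0, 0)"

end

theory Submission
  imports Defs
begin

text \<open>All iterates \<open>\<beta> ^ j * x0\<close> are nonnegative, so the loop stops at the
  least \<open>k\<close> with \<open>\<beta> ^ k * x0 \<le> xstar\<close>; one exists because the
  powers of \<open>\<beta>\<close> tend to 0. Since \<open>x0 > xstar\<close>, this \<open>k\<close>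
  has a predecessor \<open>m\<close>, whose iterate still exceeds \<open>xstar\<close>. Multiplying
  that inequality by \<open>\<beta>\<close> bounds the output from below; weakening
  \<open>xstar\<close> to \<open>\<epsilon>\<close> and taking logarithms bounds \<open>m\<close>,
  hence \<open>k\<close>. \<open>backtracking_eq_Some\<close> links this \<open>k\<close> to the
  actual run of the loop.\<close>

lemma while_option_eq_Some_funpow:
  assumes "\<not> b ((c ^^ k) s)" and "\<And>j. j < k \<Longrightarrow> b ((c ^^ j) s)"
  shows "while_option b c s = Some ((c ^^ k) s)"
proof -
  have "(LEAST j. \<not> b ((c ^^ j) s)) = k"
    using assms by (intro Least_equality) (auto simp: not_less[symmetric])
  then show ?thesis
    using assms(1) by (auto simp: while_option_def)
qed

text \<open>The counter in the state equals the exponent of \<open>\<beta>\<close>, so a single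
  power of the loop body yields both the output and the iteration count.\<close>

lemma backtracking_eq_Some:
  assumes "g (\<beta> ^ k * x0) \<le> 0" and "\<And>j. j < k \<Longrightarrow> g (\<beta> ^ j * x0) > 0"
  shows "backtracking g x0 \<beta> = Some (\<beta> ^ k * x0, k)"
proof -
  let ?c = "\<lambda>(x, k). (\<beta> * x, Suc k)"
  have iter: "(?c ^^ j) (x0, 0) = (\<beta> ^ j * x0, j)" for j
    by (induction j) auto
  show ?thesis
    unfolding backtracking_def iter[of k, symmetric]
    using assms by (intro while_option_eq_Some_funpow) (auto simp: iter not_less)
qed

theorem theorem2p1:
  fixes g :: "real \<Rightarrow> real" and xstar \<epsilon> \<beta> x0 :: real
  assumes "\<epsilon> > 0" and "xstar > \<epsilon>"
    and "\<beta> \<in> {0<..<1}"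
    and "x0 > xstar"
    and "\<forall>x\<in>{0..}. g x > 0 \<longleftrightarrow> x > xstar"
  shows "\<exists>xhat k. backtracking g x0 \<beta> = Some (xhat, k)
           \<and> g xhat \<le> 0
           \<and> int k \<le> \<lceil>log \<beta> (\<epsilon> / x0)\<rceil>
           \<and> \<beta> * xstar < xhat \<and> xhat \<le> xstar"
proof -
  have \<beta>: "0 < \<beta>" "\<beta> < 1" and pos: "0 < xstar" "0 < x0"
    using assms by auto
  have g_iff: "g (\<beta> ^ j * x0) > 0 \<longleftrightarrow> \<beta> ^ j * x0 > xstar" for j
    using assms(5) \<beta> pos by simp
  define k where "k = (LEAST k. \<beta> ^ k * x0 \<le> xstar)"
  have "\<exists>n. \<beta> ^ n < xstar / x0"
    using \<beta> pos by (intro real_arch_pow_inv) auto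
  then have "\<exists>n. \<beta> ^ n * x0 \<le> xstar"
    using pos by (auto simp: field_simps intro: less_imp_le)
  then have le: "\<beta> ^ k * x0 \<le> xstar"
    unfolding k_def by (rule LeastI_ex)
  have gt: "\<beta> ^ j * x0 > xstar" if "j < k" for j
    using not_less_Least[OF that[unfolded k_def]] by simp
  have "k \<noteq> 0"
    using le assms(4) by (intro notI) simp
  then obtain m where m: "k = Suc m"
    using not0_implies_Suc by blast
  have prev: "\<beta> ^ m * x0 > xstar"
    by (rule gt) (simp add: m)
  have "\<epsilon> / x0 < \<beta> ^ m"
    using prev assms(2) pos by (simp add: field_simps)
  then have "ln (\<epsilon> / x0) < ln (\<beta> ^ m)"
    using assms(1) \<beta> pos by (subst ln_less_cancel_iff) auto
  \<comment> \<open>Dividing by \<open>ln \<beta>\<close>, which is negative, reverses the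
    inequality.\<close>
  then have "real m < log \<beta> (\<epsilon> / x0)"
    using \<beta> by (simp add: log_def ln_realpow neg_less_divide_eq)
  then have "int k \<le> \<lceil>log \<beta> (\<epsilon> / x0)\<rceil>"
    \<comment> \<open>Strictness matters: an integer strictly below a real is at most its ceiling
      minus 1, which absorbs the extra iteration in \<open>Suc m\<close>.\<close>
    unfolding m by linarith
  moreover have "backtracking g x0 \<beta> = Some (\<beta> ^ k * x0, k)"
    using le gt g_iff by (intro backtracking_eq_Some) (auto simp: not_less[symmetric])
  moreover have "\<beta> * xstar < \<beta> ^ k * x0"
    using prev \<beta> by (simp add: m mult.assoc)
  moreover have "g (\<beta> ^ k * x0) \<le> 0"
    using le g_iff[of k] by simp
  ultimately show ?thesis
    using le by blast
qed

end
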